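(* Assume that: (a) $\mu>\mathrm{cf}(\mu)=\kappa$, and $\mu$ is a strong limit (singular) cardinal; (b) $\theta<\kappa$ is a cardinal ($\theta$ is the number of colors); (c) $\lambda$ is a cardinal with $\mu<\lambda=\mathrm{cf}(\lambda)\leq 2^\mu$; (d) $\langle\mu_\varepsilon:\varepsilon<\kappa\rangle$ is an increasing sequence of regular cardinals; (e) $\mu=\bigcup\{\mu_\varepsilon:\varepsilon<\kappa\}$; (f) $\mu_\varepsilon=\sum_{\alpha<\mu_\varepsilon}2^{|\alpha|}$ for every $\varepsilon<\kappa$; (g) $2^{\mu_\varepsilon}=\mu_\varepsilon^+$ and $2^{\mu_\varepsilon^+}=\mu_\varepsilon^{++}$ for every $\varepsilon<\kappa$; (h) for $\ell\in\{0,1,2\}$, the true cofinality $\Upsilon_\ell=\mathrm{tcf}\bigl(\prod_{\varepsilon<\kappa}\mu_\varepsilon^{+\ell},J^{\rm bd}_\kappa\bigr)$ exists; (i) $\lambda\notin\{\Upsilon_0,\Upsilon_1,\Upsilon_2\}$. Then the strong polarized relation $\binom{\lambda}{\mu}\rightarrow\binom{\lambda}{\mu}^{1,1}_\theta$ holds.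
   Context: The strong polarized relation $\binom{\lambda}{\mu}\rightarrow\binom{\lambda}{\mu}^{1,1}_\theta$ means: for every function $c:\lambda\times\mu\rightarrow\theta$ there are $A\subseteq\lambda$ and $B\subseteq\mu$ such that $|A|=\lambda$, $|B|=\mu$ and $c\upharpoonright(A\times B)$ is constant. For a cardinal $\chi$, $\chi^{+\ell}$ denotes its $\ell$-th cardinal successor ($\chi^{+0}=\chi$). $J^{\rm bd}_\kappa$ is the ideal of bounded subsets of $\kappa$. For $f,g\in\prod_{\varepsilon<\kappa}\chi_\varepsilon$, $f<_{J^{\rm bd}_\kappa}g$ means that $\{\varepsilon<\kappa: f(\varepsilon)\geq g(\varepsilon)\}$ is bounded in $\kappa$. $\mathrm{tcf}(\prod_{\varepsilon<\kappa}\chi_\varepsilon,J^{\rm bd}_\kappa)=\Upsilon$ means that $\Upsilon$ is a regular cardinal and there is a sequence $\langle f_i:i<\Upsilon\rangle$ in $\prod_{\varepsilon<\kappa}\chi_\varepsilon$ which is $<_{J^{\rm bd}_\kappa}$-increasing and cofinal (every $g$ in the product satisfies $g<_{J^{\rm bd}_\kappa}f_i$ for some $i<\Upsilon$). *)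

theory Defs
  imports Main "HOL-Library.FuncSet"
begin

unbundle cardinal_syntax

(* A cardinal is represented, as in the library, by a relation r with Card_order r: a well-order of
   minimal order type on Field r.  The elements of Field r play the role of the ordinals below the
   cardinal, and a in Field r corresponds to the ordinal underS r a.  Cardinals on different types
   are compared by \<open><o\<close>, \<open>\<le>o\<close>, \<open>=o\<close>. *)

(* Meaningful for limit r only: the library's "cofinal K r" asks for strict upper bounds in K. *)
definition cf :: "'a rel \<Rightarrow> 'a rel" where
  "cf r = |SOME K. K \<subseteq> Field r \<and> cofinal K r \<and> (\<forall>L. L \<subseteq> Field r \<and> cofinal L r \<longrightarrow> |K| \<le>o |L| )|"

definition strong_limit :: "'a rel \<Rightarrow> bool" where
  "strong_limit r \<longleftrightarrow> Cinfinite r \<and> (\<forall>s :: 'a rel. Card_order s \<and> s <o r \<longrightarrow> ctwo ^c s <o r)"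

(* r, as an ordinal, is the union of the ordinals s i: each s i is contained in r, and each
   ordinal below r is an element of some s i. *)
definition is_ord_union :: "'a rel \<Rightarrow> 'i set \<Rightarrow> ('i \<Rightarrow> 'b rel) \<Rightarrow> bool" where
  "is_ord_union r I s \<longleftrightarrow>
     (\<forall>i\<in>I. s i \<le>o r) \<and> (\<forall>a\<in>Field r. \<exists>i\<in>I. Restr r (underS r a) <o s i)"

definition Jbd :: "'k rel \<Rightarrow> 'k set set" where
  "Jbd k = {A. A \<subseteq> Field k \<and> (\<exists>b\<in>Field k. A \<subseteq> underS k b)}"

definition card_prod :: "'k rel \<Rightarrow> ('k \<Rightarrow> 'c rel) \<Rightarrow> ('k \<Rightarrow> 'c) set" where
  "card_prod k \<chi> = (\<Pi>\<^sub>E e\<in>Field k. Field (\<chi> e))"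

definition less_Jbd :: "'k rel \<Rightarrow> ('k \<Rightarrow> 'c rel) \<Rightarrow> ('k \<Rightarrow> 'c) \<Rightarrow> ('k \<Rightarrow> 'c) \<Rightarrow> bool" where
  "less_Jbd k \<chi> f g \<longleftrightarrow> {e \<in> Field k. (g e, f e) \<in> \<chi> e} \<in> Jbd k"

definition is_tcf :: "'k rel \<Rightarrow> ('k \<Rightarrow> 'c rel) \<Rightarrow> 'u rel \<Rightarrow> bool" where
  "is_tcf k \<chi> U \<longleftrightarrow> Cinfinite U \<and> regularCard U \<and>
     (\<exists>f. (\<forall>i\<in>Field U. f i \<in> card_prod k \<chi>) \<and>
          (\<forall>i j. (i, j) \<in> U \<and> i \<noteq> j \<longrightarrow> less_Jbd k \<chi> (f i) (f j)) \<and>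
          (\<forall>g\<in>card_prod k \<chi>. \<exists>i\<in>Field U. less_Jbd k \<chi> g (f i)))"

definition strong_polarized :: "'l rel \<Rightarrow> 'm rel \<Rightarrow> 't rel \<Rightarrow> bool" where
  "strong_polarized lam mu th \<longleftrightarrow>
     (\<forall>c \<in> Field lam \<times> Field mu \<rightarrow> Field th.
        \<exists>A B. A \<subseteq> Field lam \<and> B \<subseteq> Field mu \<and> |A| =o lam \<and> |B| =o mu \<and>
          (\<exists>t. \<forall>x\<in>A \<times> B. c x = t))"

lemma cofinal_Field:
  assumes "Cinfinite r"
  shows "cofinal (Field r) r"
  using assms infinite_Card_order_limit[of r] unfolding cofinal_def cinfinite_def by (metis FieldI2)

lemma cf_witness:
  assumes "Cinfinite r"
  shows "\<exists>K. K \<subseteq> Field r \<and> cofinal K r \<and> cf r = |K| \<and>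
    (\<forall>L. L \<subseteq> Field r \<and> cofinal L r \<longrightarrow> |K| \<le>o |L| )"
proof -
  let ?R = "{|K| | K. K \<subseteq> Field r \<and> cofinal K r}"
  have "?R \<noteq> {}" using cofinal_Field[OF assms] by blast
  moreover have "\<forall>s\<in>?R. Card_order s" using card_of_Card_order by blast
  ultimately have "\<exists>s\<in>?R. \<forall>s'\<in>?R. s \<le>o s'" by (rule exists_minim_Card_order)
  then have "\<exists>K. K \<subseteq> Field r \<and> cofinal K r \<and> (\<forall>L. L \<subseteq> Field r \<and> cofinal L r \<longrightarrow> |K| \<le>o |L| )"
    by blast
  from someI_ex[OF this] show ?thesis unfolding cf_def by blast
qed

lemma regularCard_iff_cf:
  assumes "Cinfinite r"
  shows "regularCard r \<longleftrightarrow> cf r =o r"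
proof -
  obtain K where K: "K \<subseteq> Field r" "cofinal K r" "cf r = |K|"
      "\<And>L. L \<subseteq> Field r \<Longrightarrow> cofinal L r \<Longrightarrow> |K| \<le>o |L|"
    using cf_witness[OF assms] by blast
  have F: "|Field r| =o r" using assms card_of_Field_ordIso by blast
  show ?thesis
  proof
    assume "regularCard r" then show "cf r =o r" using K unfolding regularCard_def by simp
  next
    assume c: "cf r =o r"
    show "regularCard r" unfolding regularCard_def
    proof (intro allI impI, elim conjE)
      fix L assume L: "L \<subseteq> Field r" "cofinal L r"
      have "r \<le>o |L|"
        using K(4)[OF L] c K(3) ordIso_ordLeq_trans ordIso_symmetric by metis
      moreover have "|L| \<le>o r" using card_of_mono1[OF L(1)] F ordLeq_ordIso_trans by blast
      ultimately show "|L| =o r" by (simp add: ordIso_iff_ordLeq)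
    qed
  qed
qed

end

theory Submission
  imports Defs
begin

text \<open>
  Fix a colouring \<open>col\<close> of \<open>lam \<times> mu\<close>, and in \<open>mu\<close> a block \<open>D e\<close> of size \<open>(mus e)\<^sup>+\<close> for each
  \<open>e < kap\<close>. A row \<open>\<alpha> < lam\<close> behaves on the block \<open>e\<close> like one of the functions \<open>D e \<rightarrow> th\<close>, of which
  there are at most \<open>2 ^ (mus e)\<^sup>+ = (mus e)\<^sup>+\<^sup>+\<close> as soon as \<open>th < mus e\<close>. The idea is to pass to \<open>lam\<close> many rows that show
  fewer than \<open>mus e\<close> behaviours on all blocks from some point on. The cardinal arithmetic then
  leaves only \<open>mus e\<close> many patterns for the columns of the block, fewer than its regular size
  \<open>(mus e)\<^sup>+\<close>, so a subset \<open>B e\<close> of full size consists of columns with the same pattern: every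
  remaining row is constant on \<open>B e\<close> (lemma \<open>common_homogeneous_set\<close>).

  The number of behaviours is brought down by one cardinal at a time, from \<open>(mus e)\<^sup>+\<^sup>+\<close> to below
  \<open>mus e\<close>, with the three true cofinalities. If the behaviours on block \<open>e\<close> are numbered
  by the ordinals below \<open>\<chi> e\<close>, every row becomes an element of the product of the \<open>\<chi> e\<close>. When \<open>lam\<close> is
  regular and different from the true cofinality \<open>U\<close> of this product, \<open>lam\<close> many rows lie below a
  single element \<open>g\<close> of it: if \<open>lam < U\<close> by regularity of \<open>U\<close>, if \<open>U < lam\<close> by the pigeonhole
  principle (lemma \<open>tcf_common_bound\<close>). These rows use only the numbers below \<open>g e\<close>, and there are
  fewer than \<open>\<chi> e\<close> of those (lemma \<open>tcf_shrink\<close>).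

  Each remaining row now induces a function from a final segment of \<open>kap\<close> to \<open>th\<close>, the constant value on each \<open>B e\<close>.
  There are fewer than \<open>mu\<close>, hence fewer than \<open>lam\<close>, such functions because \<open>mu\<close> is a strong limit,
  so \<open>lam\<close> many rows share one. The shared function splits the union of the sets \<open>B e\<close>, which has size \<open>mu\<close>,
  into at most \<open>th\<close> monochromatic parts, and since \<open>th\<close> is below the cofinality of \<open>mu\<close> one
  part has size \<open>mu\<close> (lemma \<open>cf_pigeonhole\<close>).
\<close>

section \<open>Cardinalities below a cardinal\<close>

lemma well_order_comparable:
  assumes "Well_order r" "a \<in> Field r" "b \<in> Field r"
  shows "(a, b) \<in> r \<or> (b, a) \<in> r"
  using assms wo_rel.TOTALS[of r] by (auto simp: wo_rel_def)

lemma well_order_upper_bound: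
  assumes "Well_order r" "a \<in> Field r" "b \<in> Field r"
  obtains m where "m \<in> Field r" "(a, m) \<in> r" "(b, m) \<in> r"
  using assms wo_rel.max2_greater[of r a b] by (metis FieldI2 wo_rel_def)

lemma underS_subset:
  assumes "Well_order r" "(a, b) \<in> r"
  shows "underS r a \<subseteq> underS r b"
  using assms by (meson well_order_on_def linear_order_on_def partial_order_on_def
      preorder_on_def underS_incr)

lemma card_underS_of_ordLess:
  assumes r: "Card_order r" and X: "|X| <o r"
  shows "\<exists>a\<in>Field r. ( |X| =o |underS r a| ) \<and> ( |X| =o Restr r (underS r a))"
proof -
  have W: "Well_order r" using r by (simp add: card_order_on_def)
  obtain a where a: "a \<in> Field r" "|X| =o Restr r (underS r a)"
    using ordLess_iff_ordIso_Restr[OF W card_of_Well_order] X by blast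
  have "Field (Restr r (underS r a)) = underS r a"
    using W Refl_Field_Restr2[of r "underS r a"] wo_rel.REFL[of r] underS_Field[of _ r a]
    by (auto simp: wo_rel_def)
  then have "|X| =o |underS r a|" using card_of_cong[OF a(2)] by (simp add: Field_card_of)
  then show ?thesis using a by blast
qed

lemma ordLeq_card_of_iff_not_ordLess:
  assumes "Card_order r"
  shows "r \<le>o |X| \<longleftrightarrow> \<not> |X| <o r"
  using assms not_ordLess_iff_ordLeq[OF _ card_of_Well_order, of r X]
  unfolding card_order_on_def by blast

lemma card_of_subset_Field:
  assumes "Card_order r" "X \<subseteq> Field r"
  shows "|X| \<le>o r"
  by (rule ordLeq_ordIso_trans[OF card_of_mono1[OF assms(2)] card_of_Field_ordIso[OF assms(1)]])

lemma subset_of_card: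
  assumes r: "Card_order r" and "r \<le>o |A|"
  obtains A' where "A' \<subseteq> A" "|A'| =o r"
proof -
  have F: "|Field r| =o r" using r by (rule card_of_Field_ordIso)
  obtain f where f: "inj_on f (Field r)" "f ` Field r \<subseteq> A"
    using ordIso_ordLeq_trans[OF F assms(2)] card_of_ordLeq by metis
  have "|Field r| =o |f ` Field r|" using f(1) by (metis card_of_ordIso inj_on_imp_bij_betw)
  then have "|f ` Field r| =o r" using F ordIso_symmetric ordIso_transitive by blast
  then show thesis using that f(2) by blast
qed

lemma card_subset_ordIso:
  assumes "Card_order r" "X \<subseteq> Field r" "r \<le>o |X|"
  shows "|X| =o r"
  using assms card_of_subset_Field ordIso_iff_ordLeq by blast

text \<open>
  The uniform bound \<open>underS r a\<close> on the summands is what makes this hold for singular \<open>r\<close> as well: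
  index set and summands all embed into one initial segment, whose square is finite or not larger than it.
\<close>
lemma Sigma_ordLess:
  assumes r: "Cinfinite r" and I: "|I| <o r" and a: "a \<in> Field r"
    and A: "\<And>i. i \<in> I \<Longrightarrow> |A i| \<le>o |underS r a|"
  shows "|SIGMA i : I. A i| <o r"
proof -
  have C: "Card_order r" and W: "Well_order r" using r by (auto simp: card_order_on_def)
  obtain b where b: "b \<in> Field r" "|I| =o |underS r b|"
    using card_underS_of_ordLess[OF C I] by blast
  obtain m where m: "m \<in> Field r" "(a, m) \<in> r" "(b, m) \<in> r"
    using well_order_upper_bound[OF W a b(1)] .
  let ?S = "underS r m"
  have S: "|?S| <o r" using card_of_underS[OF C m(1)] .
  have IS: "|I| \<le>o |?S|"
    by (rule ordIso_ordLeq_trans[OF b(2) card_of_mono1[OF underS_subset[OF W m(3)]]])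
  have AS: "|A i| \<le>o |?S|" if "i \<in> I" for i
    by (rule ordLeq_transitive[OF A[OF that] card_of_mono1[OF underS_subset[OF W m(2)]]])
  show ?thesis
  proof (cases "finite ?S")
    case True
    then have "finite (SIGMA i : I. A i)"
      using IS AS card_of_ordLeq_finite by (metis finite_SigmaI)
    then show ?thesis
      using r by (intro Cfinite_ordLess_Cinfinite) (auto simp: cfinite_def Field_card_of card_of_card_order_on)
  next
    case False
    then show ?thesis
      using ordLeq_ordLess_trans[OF card_of_Sigma_ordLeq_infinite S] IS AS by blast
  qed
qed

lemma Times_ordLess:
  assumes r: "Cinfinite r" and "|X| <o r" "|Y| <o r"
  shows "|X \<times> Y| <o r"
proof -
  obtain a where "a \<in> Field r" "|Y| =o |underS r a|"
    using card_underS_of_ordLess[of r Y] assms by blast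
  then show ?thesis using Sigma_ordLess[OF r assms(2), of a "\<lambda>_. Y"] ordIso_iff_ordLeq by blast
qed

lemma Pow_ordLeq_Pow:
  assumes "|X| \<le>o |Y|"
  shows "|Pow X| \<le>o |Pow Y|"
proof -
  obtain f where "inj_on f X" "f ` X \<subseteq> Y" using assms card_of_ordLeq by metis
  then have "inj_on (image f) (Pow X)" "image f ` Pow X \<subseteq> Pow Y"
    by (auto intro: inj_on_image_Pow)
  then show ?thesis by (intro card_of_ordLeq[THEN iffD1] exI conjI)
qed

lemma Pow_ordLeq_ctwo:
  assumes "Card_order r" "|X| \<le>o r"
  shows "|Pow X| \<le>o ctwo ^c r"
proof -
  have "|X| \<le>o |Field r|"
    by (rule ordLeq_ordIso_trans[OF assms(2) ordIso_symmetric[OF card_of_Field_ordIso[OF assms(1)]]])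
  then have "|Pow X| \<le>o |Pow (Field r)|" by (rule Pow_ordLeq_Pow)
  also have "|Pow (Field r)| =o ctwo ^c r" unfolding ctwo_def cexp_def Field_card_of by (rule card_of_Pow_Func)
  finally show ?thesis .
qed

text \<open>A function is determined by its graph, a subset of \<open>D \<times> T\<close>.\<close>
lemma PiE_ordLeq_ctwo:
  assumes r: "Cinfinite r" and "|D| \<le>o r" "|T| \<le>o r"
  shows "|D \<rightarrow>\<^sub>E T| \<le>o ctwo ^c r"
proof -
  let ?g = "\<lambda>f. (\<lambda>x. (x, f x)) ` D"
  have "inj_on ?g (D \<rightarrow>\<^sub>E T)"
  proof (rule inj_onI)
    fix f f' assume f: "f \<in> D \<rightarrow>\<^sub>E T" "f' \<in> D \<rightarrow>\<^sub>E T" and eq: "?g f = ?g f'"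
    have "f x = f' x" if "x \<in> D" for x
    proof -
      have "(x, f x) \<in> ?g f'" using that unfolding eq[symmetric] by blast
      then show ?thesis by auto
    qed
    then show "f = f'" using f by (intro PiE_ext)
  qed
  moreover have "?g ` (D \<rightarrow>\<^sub>E T) \<subseteq> Pow (D \<times> T)" by auto
  ultimately have "|D \<rightarrow>\<^sub>E T| \<le>o |Pow (D \<times> T)|"
    by (intro card_of_ordLeq[THEN iffD1] exI conjI)
  also have "|D \<times> T| \<le>o r"
    using assms by (intro card_of_Times_ordLeq_infinite_Field) (auto simp: cinfinite_def)
  then have "|Pow (D \<times> T)| \<le>o ctwo ^c r" using r by (intro Pow_ordLeq_ctwo) auto
  finally show ?thesis .
qed

lemma ordLeq_Csum:
  assumes "i \<in> Field r" "Card_order (s i)"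
  shows "s i \<le>o (CSUM i : r. s i)"
proof -
  have "inj_on (Pair i) (Field (s i))" "Pair i ` Field (s i) \<subseteq> (SIGMA i : Field r. Field (s i))"
    using assms(1) by (auto simp: inj_on_def)
  then have "|Field (s i)| \<le>o |SIGMA i : Field r. Field (s i)|"
    by (intro card_of_ordLeq[THEN iffD1] exI conjI)
  then have "|Field (s i)| \<le>o (CSUM i : r. s i)" by (simp add: BNF_Cardinal_Arithmetic.Csum_def)
  then show ?thesis
    by (rule ordIso_ordLeq_trans[OF ordIso_symmetric[OF card_of_Field_ordIso[OF assms(2)]]])
qed

text \<open>
  The definition of a strong limit speaks about cardinals on the type of \<open>r\<close> only. A set \<open>X\<close> of any
  other type is first moved there, onto an initial segment of \<open>r\<close>.
\<close>
lemma strong_limit_Pow: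
  fixes r :: "'a rel" and X :: "'b set"
  assumes r: "strong_limit r" and X: "|X| <o r"
  shows "|Pow X| <o r"
proof -
  have C: "Card_order r" using r by (simp add: strong_limit_def)
  obtain a where a: "a \<in> Field r" "|X| =o |underS r a|"
    using card_underS_of_ordLess[OF C X] by blast
  have "ctwo ^c |underS r a| <o r"
    using r card_of_underS[OF C a(1)] card_of_Card_order by (auto simp: strong_limit_def)
  moreover have "|Pow X| \<le>o ctwo ^c |underS r a|"
    using a(2) by (intro Pow_ordLeq_ctwo card_of_Card_order ordIso_imp_ordLeq)
  ultimately show ?thesis by (rule ordLeq_ordLess_trans[rotated])
qed

section \<open>Pigeonhole principles\<close>

lemma stable_pigeonhole:
  assumes r: "Card_order r" "stable r" and A: "r \<le>o |A|" and f: "|f ` A| <o r"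
  obtains s where "s \<in> f ` A" "r \<le>o |{x \<in> A. f x = s}|"
proof -
  have "\<exists>s\<in>f ` A. r \<le>o |{x \<in> A. f x = s}|"
  proof (rule ccontr)
    assume "\<not> ?thesis"
    then have "|{x \<in> A. f x = s}| <o r" if "s \<in> f ` A" for s
      using that by (auto simp: ordLeq_card_of_iff_not_ordLess[OF r(1)])
    then have "|\<Union>s\<in>f ` A. {x \<in> A. f x = s}| <o r" by (rule stable_UNION[OF r(2) f])
    moreover have "(\<Union>s\<in>f ` A. {x \<in> A. f x = s}) = A" by auto
    ultimately show False using A ordLeq_card_of_iff_not_ordLess[OF r(1), of A] by simp
  qed
  then show thesis using that by blast
qed

text \<open>
  For singular \<open>r\<close> the number of pieces has to be compared with the cofinality. If all pieces were
  small, the ordinals measuring their sizes would be too few to be cofinal in \<open>r\<close>, so all pieces would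
  be bounded by one ordinal below \<open>r\<close>.
\<close>
lemma cf_pigeonhole:
  assumes r: "Cinfinite r" and I: "|I| <o cf r" "|I| <o r" and X: "r \<le>o |\<Union>i\<in>I. X i|"
  shows "\<exists>i\<in>I. r \<le>o |X i|"
proof (rule ccontr)
  have C: "Card_order r" and W: "Well_order r" using r by (auto simp: card_order_on_def)
  assume "\<not> ?thesis"
  then have "|X i| <o r" if "i \<in> I" for i
    using that by (simp add: ordLeq_card_of_iff_not_ordLess[OF C])
  then have "\<forall>i\<in>I. \<exists>a\<in>Field r. |X i| =o |underS r a|"
    using card_underS_of_ordLess[OF C] by fast
  then obtain a where a: "\<And>i. i \<in> I \<Longrightarrow> a i \<in> Field r" "\<And>i. i \<in> I \<Longrightarrow> |X i| =o |underS r (a i)|"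
    by metis
  have "|a ` I| <o cf r" by (rule ordLeq_ordLess_trans[OF card_of_image I(1)])
  moreover have "cf r \<le>o |L|" if "L \<subseteq> Field r" "cofinal L r" for L
    using cf_witness[OF r] that by auto
  ultimately have "\<not> cofinal (a ` I) r" using a(1) not_ordLess_ordLeq by blast
  then obtain b where b: "b \<in> Field r" "\<And>i. i \<in> I \<Longrightarrow> b = a i \<or> (b, a i) \<notin> r"
    unfolding cofinal_def by blast
  have ab: "(a i, b) \<in> r" if "i \<in> I" for i
    using b(2)[OF that] well_order_comparable[OF W a(1)[OF that] b(1)]
      well_order_comparable[OF W b(1) b(1)] by blast
  have "|X i| \<le>o |underS r b|" if "i \<in> I" for i
    by (rule ordIso_ordLeq_trans[OF a(2)[OF that] card_of_mono1[OF underS_subset[OF W ab[OF that]]]])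
  then have "|SIGMA i : I. X i| <o r" by (rule Sigma_ordLess[OF r I(2) b(1)])
  then have "|\<Union>i\<in>I. X i| <o r" by (rule ordLeq_ordLess_trans[OF card_of_UNION_Sigma])
  then show False using X ordLeq_card_of_iff_not_ordLess[OF C, of "\<Union>i\<in>I. X i"] by simp
qed

lemma cf_infinite:
  assumes r: "Cinfinite r"
  shows "cinfinite (cf r)"
proof -
  have W: "Well_order r" and Tr: "trans r" and An: "antisym r"
    using r wo_rel.TRANS[of r] wo_rel.ANTISYM[of r] by (auto simp: card_order_on_def wo_rel_def)
  obtain K where K: "K \<subseteq> Field r" "cofinal K r" "cf r = |K|" using cf_witness[OF r] by blast
  have "infinite K"
  proof
    assume "finite K"
    then have "\<exists>b\<in>Field r. \<forall>a\<in>K. (a, b) \<in> r" using K(1)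
    proof (induction K)
      case empty
      then show ?case using r by (auto simp: cinfinite_def) (metis equals0I finite.emptyI)
    next
      case (insert x K)
      then obtain b where "b \<in> Field r" "\<forall>a\<in>K. (a, b) \<in> r" by blast
      moreover obtain m where "m \<in> Field r" "(x, m) \<in> r" "(b, m) \<in> r"
        using well_order_upper_bound[OF W, of x b] insert.prems calculation by blast
      ultimately show ?case using Tr unfolding trans_def by blast
    qed
    then obtain b where b: "b \<in> Field r" "\<forall>a\<in>K. (a, b) \<in> r" by blast
    then obtain a where "a \<in> K" "b \<noteq> a" "(b, a) \<in> r" using K(2) unfolding cofinal_def by blast
    then show False using b An unfolding antisym_def by blast
  qed
  then show ?thesis using K(3) by (simp add: cinfinite_def Field_card_of)
qed

section \<open>True cofinalities different from a regular cardinal\<close>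

lemma Jbd_Un:
  assumes W: "Well_order k" and "A \<in> Jbd k" "B \<in> Jbd k"
  shows "A \<union> B \<in> Jbd k"
proof -
  obtain a b where ab: "a \<in> Field k" "A \<subseteq> underS k a" "b \<in> Field k" "B \<subseteq> underS k b"
    using assms by (auto simp: Jbd_def)
  obtain m where "m \<in> Field k" "(a, m) \<in> k" "(b, m) \<in> k"
    using well_order_upper_bound[OF W ab(1,3)] .
  then have "A \<union> B \<subseteq> underS k m" "m \<in> Field k"
    using ab underS_subset[OF W, of a m] underS_subset[OF W, of b m] by auto
  then show ?thesis using assms(2,3) unfolding Jbd_def by blast
qed

lemma Jbd_subset: "A \<in> Jbd k \<Longrightarrow> B \<subseteq> A \<Longrightarrow> B \<in> Jbd k"
  unfolding Jbd_def by blast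

lemma less_Jbd_trans:
  assumes k: "Well_order k" and \<chi>: "\<And>e. e \<in> Field k \<Longrightarrow> Well_order (\<chi> e)"
    and mem: "f \<in> card_prod k \<chi>" "g \<in> card_prod k \<chi>" "h \<in> card_prod k \<chi>"
    and less: "less_Jbd k \<chi> f g" "less_Jbd k \<chi> g h"
  shows "less_Jbd k \<chi> f h"
proof -
  have "(g e, f e) \<in> \<chi> e \<or> (h e, g e) \<in> \<chi> e" if e: "e \<in> Field k" and hf: "(h e, f e) \<in> \<chi> e" for e
  proof -
    have "f e \<in> Field (\<chi> e)" "g e \<in> Field (\<chi> e)" "h e \<in> Field (\<chi> e)"
      using mem e by (auto simp: card_prod_def)
    moreover have "trans (\<chi> e)" using \<chi>[OF e] wo_rel.TRANS by (auto simp: wo_rel_def)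
    ultimately show ?thesis using hf well_order_comparable[OF \<chi>[OF e]] unfolding trans_def by blast
  qed
  then have "{e \<in> Field k. (h e, f e) \<in> \<chi> e}
      \<subseteq> {e \<in> Field k. (g e, f e) \<in> \<chi> e} \<union> {e \<in> Field k. (h e, g e) \<in> \<chi> e}" by blast
  moreover have "\<dots> \<in> Jbd k" using Jbd_Un[OF k] less by (simp add: less_Jbd_def)
  ultimately show ?thesis unfolding less_Jbd_def by (rule Jbd_subset[rotated])
qed

text \<open>
  Each \<open>F x\<close> lies below some \<open>f (h x)\<close> of the scale \<open>f\<close> of length \<open>U\<close>. For \<open>lam < U\<close> the indices \<open>h x\<close>
  are bounded in \<open>U\<close>; for \<open>U < lam\<close> one index occurs \<open>lam\<close> many times. Since \<open>k < lam\<close>, the point from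
  which the inequalities hold can be made the same for all rows.
\<close>
lemma tcf_common_bound:
  assumes lam: "Cinfinite lam" "regularCard lam"
    and k: "Card_order k" "k <o lam"
    and \<chi>: "\<And>e. e \<in> Field k \<Longrightarrow> Card_order (\<chi> e)"
    and tcf: "is_tcf k \<chi> U" and ne: "\<not> lam =o U"
    and A: "lam \<le>o |A|" and F: "\<And>x. x \<in> A \<Longrightarrow> F x \<in> card_prod k \<chi>"
  obtains A' g b where "A' \<subseteq> A" "lam \<le>o |A'|" "g \<in> card_prod k \<chi>" "b \<in> Field k"
    "\<And>x e. x \<in> A' \<Longrightarrow> e \<in> Field k - underS k b \<Longrightarrow> F x e \<in> underS (\<chi> e) (g e)"
proof -
  have Wk: "Well_order k" and W\<chi>: "\<And>e. e \<in> Field k \<Longrightarrow> Well_order (\<chi> e)"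
    using k \<chi> by (auto simp: card_order_on_def)
  have C: "Card_order lam" and st: "stable lam"
    using lam regularCard_stable[of lam] by (auto simp: cinfinite_def)
  obtain f where U: "Cinfinite U" "regularCard U"
    and f: "\<And>i. i \<in> Field U \<Longrightarrow> f i \<in> card_prod k \<chi>"
    and inc: "\<And>i j. (i, j) \<in> U \<Longrightarrow> i \<noteq> j \<Longrightarrow> less_Jbd k \<chi> (f i) (f j)"
    and cof: "\<And>g. g \<in> card_prod k \<chi> \<Longrightarrow> \<exists>i\<in>Field U. less_Jbd k \<chi> g (f i)"
    using tcf unfolding is_tcf_def by blast
  have WU: "Well_order U" using U by (auto simp: card_order_on_def)
  have "\<forall>x\<in>A. \<exists>i\<in>Field U. less_Jbd k \<chi> (F x) (f i)" using cof F by blast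
  then obtain h where h: "\<And>x. x \<in> A \<Longrightarrow> h x \<in> Field U" "\<And>x. x \<in> A \<Longrightarrow> less_Jbd k \<chi> (F x) (f (h x))"
    by metis
  have "lam <o U \<or> U \<le>o lam"
    by (rule ordLess_or_ordLeq) (use C WU in \<open>simp_all add: card_order_on_def\<close>)
  moreover have "\<not> U =o lam" using ne ordIso_symmetric by blast
  ultimately have "lam <o U \<or> U <o lam" using ordLeq_iff_ordLess_or_ordIso by blast
  then have "\<exists>A1 i. A1 \<subseteq> A \<and> lam \<le>o |A1| \<and> i \<in> Field U \<and> (\<forall>x\<in>A1. less_Jbd k \<chi> (F x) (f i))"
  proof
    assume lU: "lam <o U"
    obtain A1 where A1: "A1 \<subseteq> A" "|A1| =o lam" using subset_of_card[OF C A] .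
    have "|h ` A1| <o U"
      by (rule ordLeq_ordLess_trans[OF ordLeq_ordIso_trans[OF card_of_image A1(2)] lU])
    moreover have "h ` A1 \<subseteq> Field U" using h(1) A1(1) by blast
    ultimately have "\<not> cofinal (h ` A1) U"
      using U(2) not_ordLess_ordIso unfolding regularCard_def by blast
    then obtain i where i: "i \<in> Field U" "\<And>x. x \<in> A1 \<Longrightarrow> i = h x \<or> (i, h x) \<notin> U"
      unfolding cofinal_def by blast
    have "less_Jbd k \<chi> (F x) (f i)" if x: "x \<in> A1" for x
    proof (cases "i = h x")
      case True
      then show ?thesis using h(2) x A1(1) by blast
    next
      case False
      then have "(h x, i) \<in> U"
        using i(2)[OF x] well_order_comparable[OF WU i(1)] h(1) x A1(1) by blast
      then have "less_Jbd k \<chi> (f (h x)) (f i)" using inc False by blast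
      then show ?thesis
        using less_Jbd_trans[OF Wk W\<chi> F f f] h x A1(1) i(1) by (meson subsetD)
    qed
    then show ?thesis using A1 i(1) ordIso_iff_ordLeq by blast
  next
    assume Ul: "U <o lam"
    have "|h ` A| \<le>o U" using h(1) by (intro card_of_subset_Field) (use U in auto)
    then have "|h ` A| <o lam" using Ul by (rule ordLeq_ordLess_trans)
    then obtain i where "i \<in> h ` A" "lam \<le>o |{x \<in> A. h x = i}|"
      using stable_pigeonhole[OF C st A] by blast
    then show ?thesis using h by (intro exI[of _ "{x \<in> A. h x = i}"] exI[of _ i]) force
  qed
  then obtain A1 i where A1: "A1 \<subseteq> A" "lam \<le>o |A1|" "i \<in> Field U"
    and less: "\<And>x. x \<in> A1 \<Longrightarrow> less_Jbd k \<chi> (F x) (f i)" by blast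
  have "\<forall>x\<in>A1. \<exists>b\<in>Field k. {e \<in> Field k. (f i e, F x e) \<in> \<chi> e} \<subseteq> underS k b"
    using less unfolding less_Jbd_def Jbd_def by blast
  then obtain b where b: "\<And>x. x \<in> A1 \<Longrightarrow> b x \<in> Field k"
      "\<And>x. x \<in> A1 \<Longrightarrow> {e \<in> Field k. (f i e, F x e) \<in> \<chi> e} \<subseteq> underS k (b x)" by metis
  have "|b ` A1| \<le>o k" using b(1) by (intro card_of_subset_Field[OF k(1)]) auto
  then have "|b ` A1| <o lam" using k(2) by (rule ordLeq_ordLess_trans)
  then obtain b0 where b0: "b0 \<in> b ` A1" "lam \<le>o |{x \<in> A1. b x = b0}|"
    using stable_pigeonhole[OF C st A1(2)] by blast
  have "F x e \<in> underS (\<chi> e) (f i e)"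
    if "x \<in> {x \<in> A1. b x = b0}" and e: "e \<in> Field k - underS k b0" for x e
  proof -
    have n: "(f i e, F x e) \<notin> \<chi> e" using b(2) that by blast
    have "f i e \<in> Field (\<chi> e)" "F x e \<in> Field (\<chi> e)"
      using f[OF A1(3)] F A1(1) that by (auto simp: card_prod_def)
    then have "(F x e, f i e) \<in> \<chi> e" using n well_order_comparable[OF W\<chi>] e by blast
    then show ?thesis using n by (auto simp: underS_def)
  qed
  moreover have "b0 \<in> Field k" using b0(1) b(1) by blast
  ultimately show thesis
    using that[of "{x \<in> A1. b x = b0}" "f i" b0] A1 b0(2) f[OF A1(3)] by blast
qed

text \<open>
  One step of the descent: \<open>X x e\<close> is the behaviour of row \<open>x\<close> on block \<open>e\<close>. Numbering the
  behaviours on block \<open>e\<close> by \<open>\<chi> e\<close> turns the rows into elements of the product, and a common bound \<open>g\<close>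
  leaves only the numbers below \<open>g e\<close> on all late blocks.
\<close>
lemma tcf_shrink:
  assumes lam: "Cinfinite lam" "regularCard lam"
    and k: "Card_order k" "k <o lam"
    and \<chi>: "\<And>e. e \<in> Field k \<Longrightarrow> Cinfinite (\<chi> e)"
    and tcf: "is_tcf k \<chi> U" and ne: "\<not> lam =o U"
    and A: "lam \<le>o |A|" and b: "b \<in> Field k"
    and few: "\<And>e. e \<in> Field k - underS k b \<Longrightarrow> |(\<lambda>x. X x e) ` A| \<le>o \<chi> e"
  obtains A' b' where "A' \<subseteq> A" "lam \<le>o |A'|" "b' \<in> Field k"
    "\<And>e. e \<in> Field k - underS k b' \<Longrightarrow> |(\<lambda>x. X x e) ` A'| <o \<chi> e"
proof -
  have Wk: "Well_order k" using k by (auto simp: card_order_on_def)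
  have "\<exists>j. j ` (\<lambda>x. X x e) ` A \<subseteq> Field (\<chi> e) \<and>
      (e \<notin> underS k b \<longrightarrow> inj_on j ((\<lambda>x. X x e) ` A))" if e: "e \<in> Field k" for e
  proof (cases "e \<in> underS k b")
    case True
    \<comment> \<open>An early block may have too many behaviours; any value in the field keeps the row in the product.\<close>
    obtain z where "z \<in> Field (\<chi> e)" using \<chi>[OF e] by (auto simp: cinfinite_def) (metis equals0I finite.emptyI)
    then show ?thesis using True by (intro exI[of _ "\<lambda>_. z"]) auto
  next
    case False
    then have "|(\<lambda>x. X x e) ` A| \<le>o \<chi> e" using few e by blast
    then have "|(\<lambda>x. X x e) ` A| \<le>o |Field (\<chi> e)|"
      using \<chi>[OF e] by (blast intro: ordLeq_ordIso_trans ordIso_symmetric card_of_Field_ordIso)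
    then have "\<exists>j. inj_on j ((\<lambda>x. X x e) ` A) \<and> j ` (\<lambda>x. X x e) ` A \<subseteq> Field (\<chi> e)"
      by (rule card_of_ordLeq[THEN iffD2])
    then show ?thesis by blast
  qed
  then obtain j where j: "\<And>e. e \<in> Field k \<Longrightarrow> j e ` (\<lambda>x. X x e) ` A \<subseteq> Field (\<chi> e)"
    "\<And>e. e \<in> Field k - underS k b \<Longrightarrow> inj_on (j e) ((\<lambda>x. X x e) ` A)" by (metis DiffD1 DiffD2)
  define F where "F x = restrict (\<lambda>e. j e (X x e)) (Field k)" for x
  have "F x \<in> card_prod k \<chi>" if "x \<in> A" for x
    using j(1) that unfolding F_def card_prod_def by auto
  then obtain A' g b1 where A': "A' \<subseteq> A" "lam \<le>o |A'|" "g \<in> card_prod k \<chi>" "b1 \<in> Field k"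
    and bd: "\<And>x e. x \<in> A' \<Longrightarrow> e \<in> Field k - underS k b1 \<Longrightarrow> F x e \<in> underS (\<chi> e) (g e)"
    using tcf_common_bound[OF lam k _ tcf ne A, of F] \<chi> by metis
  obtain m where m: "m \<in> Field k" "(b, m) \<in> k" "(b1, m) \<in> k"
    using well_order_upper_bound[OF Wk b A'(4)] .
  have "|(\<lambda>x. X x e) ` A'| <o \<chi> e" if e: "e \<in> Field k - underS k m" for e
  proof -
    have e2: "e \<in> Field k - underS k b" "e \<in> Field k - underS k b1"
      using e underS_subset[OF Wk m(2)] underS_subset[OF Wk m(3)] by auto
    have "inj_on (j e) ((\<lambda>x. X x e) ` A')" using j(2)[OF e2(1)] A'(1) by (meson image_mono inj_on_subset)
    moreover have "j e ` (\<lambda>x. X x e) ` A' \<subseteq> underS (\<chi> e) (g e)"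
      using bd e2(2) unfolding F_def by auto
    ultimately have "|(\<lambda>x. X x e) ` A'| \<le>o |underS (\<chi> e) (g e)|"
      by (intro card_of_ordLeq[THEN iffD1] exI conjI)
    moreover have "|underS (\<chi> e) (g e)| <o \<chi> e"
      using card_of_underS[of "\<chi> e" "g e"] \<chi> e2 A'(3) unfolding card_prod_def by blast
    ultimately show ?thesis by (rule ordLeq_ordLess_trans)
  qed
  then show thesis using that A' m(1) by blast
qed

section \<open>Homogeneous sets for few functions\<close>

text \<open>
  A point \<open>x\<close> is classified by its pattern \<open>\<phi> x\<close>, the values of all \<open>h \<in> H\<close> at \<open>x\<close>, which is a subset
  of \<open>H \<times> T\<close>. As \<open>|H \<times> T| < r\<close>, the weak power hypothesis on \<open>r\<close> bounds the number of patterns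
  by \<open>r\<close>, and \<open>r\<^sup>+\<close> is regular.
\<close>
lemma common_homogeneous_set:
  assumes r: "Cinfinite r"
    and pow: "\<And>a. a \<in> Field r \<Longrightarrow> ctwo ^c |underS r a| \<le>o r"
    and H: "|H| <o r" and T: "|T| <o r"
    and D: "cardSuc r \<le>o |D|" and HT: "H \<subseteq> D \<rightarrow> T"
  obtains B where "B \<subseteq> D" "cardSuc r \<le>o |B|" "B \<noteq> {}"
    "\<And>h x y. h \<in> H \<Longrightarrow> x \<in> B \<Longrightarrow> y \<in> B \<Longrightarrow> h x = h y"
proof -
  have C: "Card_order r" using r by blast
  have st: "stable (cardSuc r)"
    using r infinite_cardSuc_regularCard[of r] regularCard_stable[of "cardSuc r"]
    by (simp add: cardSuc_Card_order cinfinite_def cardSuc_finite)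
  define \<phi> where "\<phi> x = (\<lambda>h. (h, h x)) ` H" for x
  obtain a where a: "a \<in> Field r" "|H \<times> T| =o |underS r a|"
    using card_underS_of_ordLess[OF C Times_ordLess[OF r H T]] by blast
  have "\<phi> ` D \<subseteq> Pow (H \<times> T)" using HT by (auto simp: \<phi>_def)
  then have "|\<phi> ` D| \<le>o |Pow (H \<times> T)|" by (rule card_of_mono1)
  also have "|Pow (H \<times> T)| \<le>o ctwo ^c |underS r a|"
    using a(2) by (intro Pow_ordLeq_ctwo card_of_Card_order ordIso_imp_ordLeq)
  also have "ctwo ^c |underS r a| \<le>o r" by (rule pow[OF a(1)])
  also have "r <o cardSuc r" using C by (rule cardSuc_greater)
  finally have "|\<phi> ` D| <o cardSuc r" .
  then obtain s where s: "s \<in> \<phi> ` D" "cardSuc r \<le>o |{x \<in> D. \<phi> x = s}|"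
    using stable_pigeonhole[OF cardSuc_Card_order[OF C] st D] by blast
  have "h x = h y" if "h \<in> H" "\<phi> x = \<phi> y" for h x y
  proof -
    have "(h, h x) \<in> \<phi> y" using that by (auto simp: \<phi>_def)
    then show ?thesis by (auto simp: \<phi>_def)
  qed
  then show thesis using that[of "{x \<in> D. \<phi> x = s}"] s by auto
qed

section \<open>The polarized relation\<close>

theorem theorem5p1:
  fixes mu :: "'m rel" and kap :: "'k rel" and th :: "'t rel" and lam :: "'l rel"
    and mus :: "'k \<Rightarrow> 'e rel"
    and U0 :: "'u0 rel" and U1 :: "'u1 rel" and U2 :: "'u2 rel"
  assumes a: "strong_limit mu" "Card_order kap" "cf mu =o kap" "kap <o mu"
    and b: "Card_order th" "th <o kap"
    and c: "Card_order lam" "mu <o lam" "lam =o cf lam" "lam \<le>o ctwo ^c mu"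
    and d: "\<And>e. e \<in> Field kap \<Longrightarrow> Cinfinite (mus e) \<and> regularCard (mus e)"
           "\<And>e e'. (e, e') \<in> kap \<Longrightarrow> e \<noteq> e' \<Longrightarrow> mus e <o mus e'"
    and e: "is_ord_union mu (Field kap) mus"
    and f: "\<And>e. e \<in> Field kap \<Longrightarrow> mus e =o (CSUM a : mus e. ctwo ^c |underS (mus e) a| )"
    and g: "\<And>e. e \<in> Field kap \<Longrightarrow> ctwo ^c mus e =o cardSuc (mus e)"
           "\<And>e. e \<in> Field kap \<Longrightarrow> ctwo ^c cardSuc (mus e) =o cardSuc (cardSuc (mus e))"
    and h: "is_tcf kap mus U0"
           "is_tcf kap (\<lambda>e. cardSuc (mus e)) U1"
           "is_tcf kap (\<lambda>e. cardSuc (cardSuc (mus e))) U2"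
    and i: "\<not> lam =o U0" "\<not> lam =o U1" "\<not> lam =o U2"
  shows "strong_polarized lam mu th"
proof -
  let ?K = "Field kap"
  have mu: "Cinfinite mu" and Cmu: "Card_order mu" using a(1) by (auto simp: strong_limit_def)
  have lam: "Cinfinite lam" using c(1) cinfinite_mono[OF ordLess_imp_ordLeq[OF c(2)]] mu by blast
  have reg: "regularCard lam" using regularCard_iff_cf[OF lam] c(3) ordIso_symmetric by blast
  have stl: "stable lam" using lam reg regularCard_stable by (auto simp: cinfinite_def)
  have kl: "kap <o lam" using a(4) c(2) by (rule ordLess_transitive)
  have Wk: "Well_order kap" using a(2) by (simp add: card_order_on_def)
  have kinf: "cinfinite kap"
    using cinfinite_mono[OF ordIso_imp_ordLeq[OF a(3)]] cf_infinite[OF mu] by blast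
  have Cm: "Card_order (mus e)" if "e \<in> ?K" for e using d(1)[OF that] by blast
  have le_mu: "cardSuc (mus e) \<le>o mu" if ke: "e \<in> ?K" for e
  proof -
    obtain e' where e': "e' \<in> ?K" "e \<noteq> e'" "(e, e') \<in> kap"
      using infinite_Card_order_limit[OF a(2) _ ke] kinf by (auto simp: cinfinite_def)
    have "cardSuc (mus e) \<le>o mus e'"
      using d(2)[OF e'(3,2)] cardSuc_ordLess_ordLeq Cm ke e'(1) by blast
    also have "mus e' \<le>o mu" using e e'(1) by (simp add: is_ord_union_def)
    finally show ?thesis .
  qed
  have mus_mono: "mus e \<le>o mus e'" if "(e, e') \<in> kap" for e e'
    using d(2)[OF that] ordLess_imp_ordLeq Cm ordLeq_refl[of "mus e"] that
    by (cases "e = e'") (auto simp: Field_def)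
  \<comment> \<open>Every size below \<open>mu\<close> is exceeded by some \<open>mus e\<close>: this bounds \<open>th\<close> now and at the end shows
      that the union of the homogeneous sets is large.\<close>
  have mus_unbounded: "\<exists>e\<in>?K. |X| <o mus e" if X: "|X| <o mu" for X :: "'z set"
  proof -
    obtain z where z: "z \<in> Field mu" "|X| =o Restr mu (underS mu z)"
      using card_underS_of_ordLess[OF Cmu X] by blast
    then obtain e where "e \<in> ?K" "Restr mu (underS mu z) <o mus e"
      using e by (auto simp: is_ord_union_def)
    then show ?thesis using z(2) ordIso_ordLess_trans by blast
  qed
  have th_mu: "|Field th| <o mu"
    using ordIso_ordLess_trans[OF card_of_Field_ordIso[OF b(1)] ordLess_transitive[OF b(2) a(4)]] .
  obtain b0 where b0: "b0 \<in> ?K" "|Field th| <o mus b0" using mus_unbounded[OF th_mu] by blast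
  have above: "(b', x) \<in> kap" if "x \<in> ?K - underS kap b'" "b' \<in> ?K" for b' x
    using that well_order_comparable[OF Wk, of b' x] well_order_comparable[OF Wk, of b' b']
    by (auto simp: underS_def)
  have th_small: "|Field th| <o mus x" if "x \<in> ?K - underS kap b0" for x
    using ordLess_ordLeq_trans[OF b0(2) mus_mono[OF above[OF that b0(1)]]] .
  show ?thesis unfolding strong_polarized_def
  proof
    fix col assume "col \<in> Field lam \<times> Field mu \<rightarrow> Field th"
    then have colF: "col (\<alpha>, \<beta>) \<in> Field th" if "\<alpha> \<in> Field lam" "\<beta> \<in> Field mu" for \<alpha> \<beta>
      using that by auto
    have "\<exists>D. D \<subseteq> Field mu \<and> |D| =o cardSuc (mus x)" if x: "x \<in> ?K" for x
    proof -
      have "cardSuc (mus x) \<le>o |Field mu|"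
        using ordLeq_ordIso_trans[OF le_mu[OF x] ordIso_symmetric[OF card_of_Field_ordIso[OF Cmu]]] .
      then show ?thesis using subset_of_card[OF cardSuc_Card_order[OF Cm[OF x]]] by blast
    qed
    then have "\<forall>x\<in>?K. \<exists>D. D \<subseteq> Field mu \<and> |D| =o cardSuc (mus x)" by blast
    from bchoice[OF this] obtain D where D: "\<And>x. x \<in> ?K \<Longrightarrow> D x \<subseteq> Field mu"
      "\<And>x. x \<in> ?K \<Longrightarrow> |D x| =o cardSuc (mus x)" by blast
    define X where "X \<alpha> x = restrict (\<lambda>\<beta>. col (\<alpha>, \<beta>)) (D x)" for \<alpha> x
    have inf1: "Cinfinite (cardSuc (mus x))" and inf2: "Cinfinite (cardSuc (cardSuc (mus x)))"
      if "x \<in> ?K" for x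
      using Cinfinite_cardSuc[of "mus x"] Cinfinite_cardSuc[of "cardSuc (mus x)"] d(1)[OF that] by auto
    have inf0: "Cinfinite (mus x)" if "x \<in> ?K" for x using d(1)[OF that] by blast
    \<comment> \<open>The descent: the bound on the number of behaviours on late blocks falls from \<open>(mus x)\<^sup>+\<^sup>+\<close> through
        \<open>(mus x)\<^sup>+\<close> to below \<open>mus x\<close>; below a successor means at most its predecessor, so the
        steps fit together.\<close>
    have few2: "|(\<lambda>\<alpha>. X \<alpha> x) ` Field lam| \<le>o cardSuc (cardSuc (mus x))"
      if x: "x \<in> ?K - underS kap b0" for x
    proof -
      have k: "x \<in> ?K" using x by blast
      have "(\<lambda>\<alpha>. X \<alpha> x) ` Field lam \<subseteq> D x \<rightarrow>\<^sub>E Field th"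
        using colF D(1)[OF k] by (auto simp: X_def)
      then have "|(\<lambda>\<alpha>. X \<alpha> x) ` Field lam| \<le>o |D x \<rightarrow>\<^sub>E Field th|" by (rule card_of_mono1)
      also have "|D x \<rightarrow>\<^sub>E Field th| \<le>o ctwo ^c cardSuc (mus x)"
      proof (rule PiE_ordLeq_ctwo[OF inf1[OF k]])
        show "|D x| \<le>o cardSuc (mus x)" using D(2)[OF k] by (rule ordIso_imp_ordLeq)
        show "|Field th| \<le>o cardSuc (mus x)"
          using ordLess_transitive[OF th_small[OF x] cardSuc_greater[OF Cm[OF k]]]
          by (rule ordLess_imp_ordLeq)
      qed
      also have "ctwo ^c cardSuc (mus x) =o cardSuc (cardSuc (mus x))" by (rule g(2)[OF k])
      finally show ?thesis .
    qed
    have lamF: "lam \<le>o |Field lam|"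
      using card_of_Field_ordIso[OF c(1)] ordIso_iff_ordLeq by blast
    obtain A2 b2 where A2: "A2 \<subseteq> Field lam" "lam \<le>o |A2|" "b2 \<in> ?K"
      "\<And>x. x \<in> ?K - underS kap b2 \<Longrightarrow> |(\<lambda>\<alpha>. X \<alpha> x) ` A2| <o cardSuc (cardSuc (mus x))"
      using tcf_shrink[where X = X, OF lam reg a(2) kl inf2 h(3) i(3) lamF b0(1) few2] by blast
    have few1: "|(\<lambda>\<alpha>. X \<alpha> x) ` A2| \<le>o cardSuc (mus x)" if "x \<in> ?K - underS kap b2" for x
      using A2(4)[OF that] cardSuc_ordLeq_ordLess[OF cardSuc_Card_order[OF Cm] card_of_Card_order] that
      by auto
    obtain A1 b1 where A1: "A1 \<subseteq> A2" "lam \<le>o |A1|" "b1 \<in> ?K"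
      "\<And>x. x \<in> ?K - underS kap b1 \<Longrightarrow> |(\<lambda>\<alpha>. X \<alpha> x) ` A1| <o cardSuc (mus x)"
      using tcf_shrink[where X = X, OF lam reg a(2) kl inf1 h(2) i(2) A2(2,3) few1] by blast
    have few0: "|(\<lambda>\<alpha>. X \<alpha> x) ` A1| \<le>o mus x" if "x \<in> ?K - underS kap b1" for x
      using A1(4)[OF that] cardSuc_ordLeq_ordLess[OF Cm card_of_Card_order] that by auto
    obtain A0 b3 where A0: "A0 \<subseteq> A1" "lam \<le>o |A0|" "b3 \<in> ?K"
      "\<And>x. x \<in> ?K - underS kap b3 \<Longrightarrow> |(\<lambda>\<alpha>. X \<alpha> x) ` A0| <o mus x"
      using tcf_shrink[where X = X, OF lam reg a(2) kl inf0 h(1) i(1) A1(2,3) few0] by blast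
    have A0l: "A0 \<subseteq> Field lam" using A0(1) A1(1) A2(1) by blast
    obtain b4 where b4: "b4 \<in> ?K" "(b0, b4) \<in> kap" "(b3, b4) \<in> kap"
      using well_order_upper_bound[OF Wk b0(1) A0(3)] .
    define E where "E = ?K - underS kap b4"
    have E: "x \<in> ?K - underS kap b0" "x \<in> ?K - underS kap b3" "x \<in> ?K" if "x \<in> E" for x
      using that underS_subset[OF Wk b4(2)] underS_subset[OF Wk b4(3)] unfolding E_def by auto
    \<comment> \<open>The remaining rows have a common homogeneous set in every late block.\<close>
    have "\<exists>B. B \<subseteq> D x \<and> cardSuc (mus x) \<le>o |B| \<and> B \<noteq> {} \<and>
        (\<forall>\<alpha>\<in>A0. \<forall>y\<in>B. \<forall>z\<in>B. col (\<alpha>, y) = col (\<alpha>, z))" if x: "x \<in> E" for x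
    proof -
      note k = E(3)[OF x]
      have pow: "ctwo ^c |underS (mus x) z| \<le>o mus x" if "z \<in> Field (mus x)" for z
        using ordLeq_ordIso_trans[OF ordLeq_Csum[OF that, of "\<lambda>z. ctwo ^c |underS (mus x) z|"]
            ordIso_symmetric[OF f[OF k]]] Card_order_cexp by blast
      have D': "cardSuc (mus x) \<le>o |D x|" using D(2)[OF k] ordIso_iff_ordLeq by blast
      have val: "(\<lambda>\<alpha>. X \<alpha> x) ` A0 \<subseteq> D x \<rightarrow> Field th"
        using colF A0l D(1)[OF k] by (auto simp: X_def subset_iff)
      obtain B where B: "B \<subseteq> D x" "cardSuc (mus x) \<le>o |B|" "B \<noteq> {}"
        and Bh: "\<And>h y z. h \<in> (\<lambda>\<alpha>. X \<alpha> x) ` A0 \<Longrightarrow> y \<in> B \<Longrightarrow> z \<in> B \<Longrightarrow> h y = h z"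
        using common_homogeneous_set[OF inf0[OF k] pow A0(4)[OF E(2)[OF x]] th_small[OF E(1)[OF x]]
            D' val] by blast
      have "col (\<alpha>, y) = col (\<alpha>, z)" if "\<alpha> \<in> A0" "y \<in> B" "z \<in> B" for \<alpha> y z
        using Bh[of "X \<alpha> x" y z] that B(1) by (auto simp: X_def subset_iff)
      then show ?thesis using B(1-3) by blast
    qed
    then have "\<forall>x\<in>E. \<exists>B. B \<subseteq> D x \<and> cardSuc (mus x) \<le>o |B| \<and> B \<noteq> {} \<and>
        (\<forall>\<alpha>\<in>A0. \<forall>y\<in>B. \<forall>z\<in>B. col (\<alpha>, y) = col (\<alpha>, z))" by blast
    from bchoice[OF this] obtain B where BB: "\<forall>x\<in>E. B x \<subseteq> D x \<and> cardSuc (mus x) \<le>o |B x| \<and> B x \<noteq> {} \<and>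
        (\<forall>\<alpha>\<in>A0. \<forall>y\<in>B x. \<forall>z\<in>B x. col (\<alpha>, y) = col (\<alpha>, z))" ..
    have B: "B x \<subseteq> D x" "cardSuc (mus x) \<le>o |B x|" "B x \<noteq> {}" if "x \<in> E" for x
      using bspec[OF BB that] by auto
    have const: "col (\<alpha>, y) = col (\<alpha>, z)" if "x \<in> E" "\<alpha> \<in> A0" "y \<in> B x" "z \<in> B x" for x \<alpha> y z
      using bspec[OF BB that(1)] that(2-4) by blast
    have Bmu: "B x \<subseteq> Field mu" if "x \<in> E" for x using B(1)[OF that] D(1)[OF E(3)[OF that]] by blast
    \<comment> \<open>A row is now described by its values at one sample point \<open>p x\<close> of each \<open>B x\<close>; the graph \<open>G\<close> of this
        description takes fewer than \<open>lam\<close> values.\<close>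
    define p where "p x = (SOME y. y \<in> B x)" for x
    have p: "p x \<in> B x" if "x \<in> E" for x using B(3)[OF that] unfolding p_def by (simp add: some_in_eq)
    define G where "G \<alpha> = (\<lambda>x. (x, col (\<alpha>, p x))) ` E" for \<alpha>
    have "col (\<alpha>, p x) \<in> Field th" if "\<alpha> \<in> A0" "x \<in> E" for \<alpha> x
      using colF A0l p Bmu that by blast
    then have "G ` A0 \<subseteq> Pow (?K \<times> Field th)" using E(3) by (auto simp: G_def)
    then have "|G ` A0| \<le>o |Pow (?K \<times> Field th)|" by (rule card_of_mono1)
    also have "|?K \<times> Field th| <o mu"
      using Times_ordLess[OF mu ordIso_ordLess_trans[OF card_of_Field_ordIso[OF a(2)] a(4)] th_mu] .
    then have "|Pow (?K \<times> Field th)| <o mu" by (rule strong_limit_Pow[OF a(1)])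
    also note c(2)
    finally have "|G ` A0| <o lam" .
    then obtain s where s: "s \<in> G ` A0" "lam \<le>o |{\<alpha> \<in> A0. G \<alpha> = s}|"
      using stable_pigeonhole[OF c(1) stl A0(2)] by blast
    define A where "A = {\<alpha> \<in> A0. G \<alpha> = s}"
    obtain \<alpha>0 where \<alpha>0: "\<alpha>0 \<in> A0" "s = G \<alpha>0" using s(1) by blast
    define t where "t x = col (\<alpha>0, p x)" for x
    have colt: "col (\<alpha>, y) = t x" if x: "x \<in> E" and "\<alpha> \<in> A" "y \<in> B x" for \<alpha> x y
    proof -
      have "\<alpha> \<in> A0" "G \<alpha> = G \<alpha>0" using that(2) \<alpha>0(2) by (auto simp: A_def)
      then have "(x, col (\<alpha>, p x)) \<in> G \<alpha>0" using x by (auto simp: G_def)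
      then have "col (\<alpha>, p x) = t x" by (auto simp: G_def t_def)
      then show ?thesis using const[OF x \<open>\<alpha> \<in> A0\<close> that(3) p[OF x]] by simp
    qed
    have tth: "t x \<in> Field th" if "x \<in> E" for x
      using colF \<alpha>0(1) A0l p[OF that] Bmu[OF that] by (auto simp: t_def)
    \<comment> \<open>The blocks may overlap, so the union is measured by its largest members, not by a sum.\<close>
    have "mu \<le>o |\<Union>x\<in>E. B x|"
    proof (rule ccontr)
      assume "\<not> ?thesis"
      then have "|\<Union>x\<in>E. B x| <o mu" by (simp add: ordLeq_card_of_iff_not_ordLess[OF Cmu])
      then obtain x where x: "x \<in> ?K" "|\<Union>x\<in>E. B x| <o mus x" using mus_unbounded by blast
      obtain m where m: "m \<in> ?K" "(x, m) \<in> kap" "(b4, m) \<in> kap"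
        using well_order_upper_bound[OF Wk x(1) b4(1)] .
      have "antisym kap" using wo_rel.ANTISYM[of kap] Wk by (simp add: wo_rel_def)
      then have mE: "m \<in> E" using m(1,3) by (auto simp: E_def underS_def antisym_def)
      have "mus x \<le>o mus m" by (rule mus_mono[OF m(2)])
      also have "mus m \<le>o cardSuc (mus m)" using Cm[OF m(1)] by (rule cardSuc_ordLeq)
      also have "cardSuc (mus m) \<le>o |B m|" by (rule B(2)[OF mE])
      also have "|B m| \<le>o |\<Union>x\<in>E. B x|" using mE by (intro card_of_mono1) blast
      finally show False using x(2) not_ordLess_ordLeq by blast
    qed
    moreover have "(\<Union>x\<in>E. B x) = (\<Union>u\<in>Field th. \<Union>x\<in>{x\<in>E. t x = u}. B x)" using tth by blast
    moreover have "|Field th| <o cf mu"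
      using ordLess_ordIso_trans[OF ordIso_ordLess_trans[OF card_of_Field_ordIso[OF b(1)] b(2)]
          ordIso_symmetric[OF a(3)]] .
    ultimately obtain u where u: "u \<in> Field th" "mu \<le>o |\<Union>x\<in>{x\<in>E. t x = u}. B x|"
      using cf_pigeonhole[OF mu _ th_mu, of "\<lambda>u. \<Union>x\<in>{x\<in>E. t x = u}. B x"] by auto
    define B' where "B' = (\<Union>x\<in>{x\<in>E. t x = u}. B x)"
    have "A \<subseteq> Field lam" "B' \<subseteq> Field mu" using A0l Bmu by (auto simp: A_def B'_def)
    moreover have "|A| =o lam" "|B'| =o mu"
      using card_subset_ordIso[OF c(1)] card_subset_ordIso[OF Cmu] calculation s(2) u(2)
      by (simp_all add: A_def B'_def)
    moreover have "\<forall>x\<in>A \<times> B'. col x = u" using colt by (auto simp: B'_def)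
    ultimately show "\<exists>A B. A \<subseteq> Field lam \<and> B \<subseteq> Field mu \<and> |A| =o lam \<and> |B| =o mu \<and>
        (\<exists>t. \<forall>x\<in>A \<times> B. col x = t)" by blast
  qed
qed

end
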